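(* Let $k$ be a field, let $S=k[x_1,\ldots,x_n]$, and let $M$ be an arbitrary monomial ideal of $S$. Then $\operatorname{pd}(S/M)=1$ if and only if $\operatorname{odom}(S/M)=1$.
   Context: $\operatorname{pd}(S/M)$ is the projective dimension of the $S$-module $S/M$, i.e. the largest $i$ such that the $i$-th Betti number of $S/M$ is nonzero. Dominance: if $L$ is a set of monomials, $m\in L$ is dominant (in $L$) in the variable $x$ if for every $m'\in L\setminus\{m\}$ the exponent of $x$ in $m$ is strictly larger than the exponent of $x$ in $m'$. $L$ is a dominant set if each of its elements is dominant in some variable. Order of dominance: let $G$ be the minimal monomial generating set of $M$. Let $\mathscr{I}$ be the class of all sequences $1\le i_1<\cdots<i_q\le n$ with $q\ge 1$ for which the following hold: (i) $G$ contains a dominant set $D=\{d_1,\ldots,d_q\}$ such that each $d_j$ is dominant (in $D$) in $x_{i_j}$; (ii) if $\operatorname{lcm}(D)=x_1^{\alpha_1}\cdots x_n^{\alpha_n}$ and $m$ is an element of $G$ dividing $\operatorname{lcm}(D)$, then $m$ is divisible by at least one of $x_{i_1}^{\alpha_{i_1}},\ldots,x_{i_q}^{\alpha_{i_q}}$. The order of dominance $\operatorname{odom}(S/M)$ is the maximum of the cardinalities $q$ of the sequences in $\mathscr{I}$.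
   Formalization: M is assumed to be a proper ideal (and n ≥ 1): for M = S the module S/M is zero, so pd(S/M) is undefined, while the definition gives odom(S/M) = 1 from G = {1}. *)

theory Defs
  imports
    "HOL-Library.Poly_Mapping"
    "HOL-Library.Extended_Nat"
    "Jordan_Normal_Form.Matrix"
begin

text \<open>
  The polynomial ring \<open>S = k[x\<^sub>1, \<dots>, x\<^sub>n]\<close> is the type \<open>('n, 'k) mpoly\<close>, where the finite linearly
  ordered type \<open>'n\<close> is the set of variables.  A monomial is represented by its exponent vector, so
  \<open>lookup t x\<close> is the exponent of the variable \<open>x\<close> in \<open>t\<close>.  The order that the library puts on
  \<open>'n \<Rightarrow>\<^sub>0 nat\<close> is lexicographic and is not divisibility.
\<close>

type_synonym 'n monom = "'n \<Rightarrow>\<^sub>0 nat"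
type_synonym ('n, 'k) mpoly = "('n \<Rightarrow>\<^sub>0 nat) \<Rightarrow>\<^sub>0 'k"

definition monom_poly :: "'n monom \<Rightarrow> ('n, 'k::field) mpoly" where
  "monom_poly t = Poly_Mapping.single t 1"

text \<open>An ideal is a submodule of the ring regarded as a module over itself.\<close>

definition ideal_gen :: "'a::comm_ring_1 set \<Rightarrow> 'a set" where
  "ideal_gen = Modules.module.span (*)"

lemma module_times: "Modules.module ((*) :: 'a::comm_ring_1 \<Rightarrow> 'a \<Rightarrow> 'a)"
  by standard (simp_all add: algebra_simps)

definition monomial_ideal :: "('n, 'k::field) mpoly set \<Rightarrow> bool" where
  "monomial_ideal M \<longleftrightarrow> (\<exists>A. M = ideal_gen (monom_poly ` A))"

definition is_min_monom_gens :: "('n, 'k::field) mpoly set \<Rightarrow> 'n monom set \<Rightarrow> bool" where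
  "is_min_monom_gens M G \<longleftrightarrow>
     ideal_gen (monom_poly ` G) = M \<and> (\<forall>H. H \<subset> G \<longrightarrow> ideal_gen (monom_poly ` H) \<noteq> M)"

definition min_monom_gens :: "('n, 'k::field) mpoly set \<Rightarrow> 'n monom set" where
  "min_monom_gens M = (THE G. is_min_monom_gens M G)"


subsection \<open>Order of dominance\<close>

definition dominant_in :: "'n monom set \<Rightarrow> 'n monom \<Rightarrow> 'n \<Rightarrow> bool" where
  "dominant_in L m x \<longleftrightarrow> m \<in> L \<and> (\<forall>m' \<in> L - {m}. Poly_Mapping.lookup m' x < Poly_Mapping.lookup m x)"

definition dominant_set :: "'n monom set \<Rightarrow> bool" where
  "dominant_set L \<longleftrightarrow> (\<forall>m \<in> L. \<exists>x. dominant_in L m x)"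

definition lcm_exponent :: "'n monom set \<Rightarrow> 'n \<Rightarrow> nat" where
  "lcm_exponent D x = (MAX d \<in> D. Poly_Mapping.lookup d x)"

text \<open>
  The list \<open>is\<close> is the sequence \<open>i\<^sub>1 < \<dots> < i\<^sub>q\<close> and \<open>ds\<close> lists \<open>d\<^sub>1, \<dots>, d\<^sub>q\<close>.  The \<open>d\<^sub>j\<close> have to be
  pairwise distinct: a one-element set is vacuously dominant in every variable.
\<close>

definition dominance_sequence :: "'n::linorder monom set \<Rightarrow> 'n list \<Rightarrow> bool" where
  "dominance_sequence G is \<longleftrightarrow>
     is \<noteq> [] \<and> sorted_wrt (<) is \<and>
     (\<exists>ds. length ds = length is \<and> distinct ds \<and> set ds \<subseteq> G \<and> dominant_set (set ds) \<and>
        (\<forall>j < length is. dominant_in (set ds) (ds ! j) (is ! j)) \<and>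
        (\<forall>m \<in> G. (\<forall>x. Poly_Mapping.lookup m x \<le> lcm_exponent (set ds) x) \<longrightarrow>
           (\<exists>j < length is. lcm_exponent (set ds) (is ! j) \<le> Poly_Mapping.lookup m (is ! j))))"

text \<open>The set below is bounded by the number of variables, so \<open>Sup\<close> is its maximum, with the value
  \<open>0\<close> if it is empty, which happens only for \<open>M = 0\<close>.\<close>

definition odom :: "('n::{finite,linorder}, 'k::field) mpoly set \<Rightarrow> nat" where
  "odom M = Sup {length is |is. dominance_sequence (min_monom_gens M) is}"


subsection \<open>Minimal free resolutions, Betti numbers and projective dimension\<close>

definition monom_degree :: "'n::finite monom \<Rightarrow> nat" where
  "monom_degree t = (\<Sum>x\<in>UNIV. Poly_Mapping.lookup t x)"

definition homogeneous :: "int \<Rightarrow> ('n::finite, 'k::field) mpoly \<Rightarrow> bool" where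
  "homogeneous d p \<longleftrightarrow> (\<forall>t \<in> Poly_Mapping.keys p. int (monom_degree t) = d)"

definition irrelevant_ideal :: "('n, 'k::field) mpoly set" where
  "irrelevant_ideal = ideal_gen (range (\<lambda>x. monom_poly (Poly_Mapping.single x 1)))"

definition mat_ker :: "'a::comm_ring_1 mat \<Rightarrow> 'a vec set" where
  "mat_ker A = {v \<in> carrier_vec (dim_col A). A *\<^sub>v v = 0\<^sub>v (dim_row A)}"

definition mat_im :: "'a::comm_ring_1 mat \<Rightarrow> 'a vec set" where
  "mat_im A = (\<lambda>v. A *\<^sub>v v) ` carrier_vec (dim_col A)"

text \<open>
  A graded free resolution \<open>\<dots> \<rightarrow> F\<^sub>2 \<rightarrow> F\<^sub>1 \<rightarrow> F\<^sub>0 \<rightarrow> S/M \<rightarrow> 0\<close> is given by the ranks \<open>b i\<close> of the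
  modules \<open>F\<^sub>i\<close> (whose elements are the vectors in \<open>carrier_vec (b i)\<close>), the degrees \<open>\<mu> i c\<close> of
  their basis elements, the matrices \<open>D i\<close> of the differentials \<open>F\<^sub>i \<rightarrow> F\<^sub>i\<^sub>-\<^sub>1\<close> for \<open>i \<ge> 1\<close> (\<open>D 0\<close> is
  not used), and the augmentation \<open>F\<^sub>0 \<rightarrow> S/M\<close>, which sends the \<open>c\<close>-th basis element to the residue
  class of the homogeneous polynomial \<open>\<epsilon> $ c\<close>.
\<close>

definition graded_free_resolution ::
  "('n::finite, 'k::field) mpoly set \<Rightarrow> (nat \<Rightarrow> nat) \<Rightarrow> (nat \<Rightarrow> nat \<Rightarrow> int) \<Rightarrow>
   ('n, 'k) mpoly vec \<Rightarrow> (nat \<Rightarrow> ('n, 'k) mpoly mat) \<Rightarrow> bool" where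
  "graded_free_resolution M b \<mu> \<epsilon> D \<longleftrightarrow>
     \<epsilon> \<in> carrier_vec (b 0) \<and>
     (\<forall>i. D (Suc i) \<in> carrier_mat (b i) (b (Suc i))) \<and>
     (\<forall>c < b 0. homogeneous (\<mu> 0 c) (\<epsilon> $ c)) \<and>
     (\<forall>i. \<forall>r < b i. \<forall>c < b (Suc i). homogeneous (\<mu> (Suc i) c - \<mu> i r) (D (Suc i) $$ (r, c))) \<and>
     (\<forall>f. \<exists>v \<in> carrier_vec (b 0). f - \<epsilon> \<bullet> v \<in> M) \<and>
     {v \<in> carrier_vec (b 0). \<epsilon> \<bullet> v \<in> M} = mat_im (D 1) \<and>
     (\<forall>i. mat_ker (D (Suc i)) = mat_im (D (Suc (Suc i))))"

definition minimal_free_resolution ::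
  "('n::finite, 'k::field) mpoly set \<Rightarrow> (nat \<Rightarrow> nat) \<Rightarrow> (nat \<Rightarrow> nat \<Rightarrow> int) \<Rightarrow>
   ('n, 'k) mpoly vec \<Rightarrow> (nat \<Rightarrow> ('n, 'k) mpoly mat) \<Rightarrow> bool" where
  "minimal_free_resolution M b \<mu> \<epsilon> D \<longleftrightarrow>
     graded_free_resolution M b \<mu> \<epsilon> D \<and>
     (\<forall>i. \<forall>r < b i. \<forall>c < b (Suc i). D (Suc i) $$ (r, c) \<in> irrelevant_ideal)"

text \<open>
  \<open>has_betti M i r\<close>: the \<open>i\<close>-th Betti number of \<open>S/M\<close> is \<open>r\<close>.  For a homogeneous ideal \<open>M\<close> there is
  exactly one such \<open>r\<close>, since the minimal graded free resolution exists and is unique up to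
  isomorphism.
\<close>

definition has_betti :: "('n::finite, 'k::field) mpoly set \<Rightarrow> nat \<Rightarrow> nat \<Rightarrow> bool" where
  "has_betti M i r \<longleftrightarrow> (\<exists>b \<mu> \<epsilon> D. minimal_free_resolution M b \<mu> \<epsilon> D \<and> b i = r)"

text \<open>The projective dimension of \<open>S/M\<close>.\<close>

definition proj_dim :: "('n::finite, 'k::field) mpoly set \<Rightarrow> enat" where
  "proj_dim M = Sup {enat i |i. \<exists>r. has_betti M i r \<and> r \<noteq> 0}"

end

theory Submission
  imports Defs
begin

text \<open>
  Both conditions say that \<open>M\<close> is principal and nonzero.  If there are two minimal generators, choose
  a pair \<open>d \<noteq> e\<close> of them whose least common multiple has the least degree; since neither divides the
  other, the pair is dominant, and minimality yields condition (ii), so the order of dominance is at least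
  2.  On the other side, a minimal resolution of \<open>S/M\<close> has \<open>F\<^sub>0 = S\<close>, and \<open>F\<^sub>2 = 0\<close> makes the row
  \<open>F\<^sub>1 \<rightarrow> S\<close> injective, so it has at most one entry, because two entries \<open>f, g\<close> satisfy the relation
  \<open>g f - f g = 0\<close>.  Conversely, over a principal ideal every minimal resolution stops at \<open>F\<^sub>1 = S\<close>,
  since a superfluous basis element would produce a syzygy with a unit entry.
\<close>

abbreviation (input) lookup :: "('a \<Rightarrow>\<^sub>0 'b::zero) \<Rightarrow> 'a \<Rightarrow> 'b" where
  "lookup \<equiv> Poly_Mapping.lookup"

abbreviation (input) keys :: "('a \<Rightarrow>\<^sub>0 'b::zero) \<Rightarrow> 'a set" where
  "keys \<equiv> Poly_Mapping.keys"

section \<open>Monomials and monomial ideals\<close>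

definition monom_dvd :: "'n monom \<Rightarrow> 'n monom \<Rightarrow> bool" where
  "monom_dvd s t \<longleftrightarrow> (\<forall>x. lookup s x \<le> lookup t x)"

lemma monom_dvd_refl [simp]: "monom_dvd t t"
  by (simp add: monom_dvd_def)

lemma monom_dvd_zero [simp]: "monom_dvd 0 t"
  by (simp add: monom_dvd_def)

lemma monom_dvd_trans: "monom_dvd r s \<Longrightarrow> monom_dvd s t \<Longrightarrow> monom_dvd r t"
  unfolding monom_dvd_def by (meson order_trans)

lemma monom_dvd_antisym: "monom_dvd s t \<Longrightarrow> monom_dvd t s \<Longrightarrow> s = t"
  by (auto simp: monom_dvd_def intro!: poly_mapping_eqI antisym)

lemma monom_dvd_zero_right: "monom_dvd t 0 \<Longrightarrow> t = 0"
  by (auto simp: monom_dvd_def intro!: poly_mapping_eqI)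

lemma monom_dvd_add: "monom_dvd t (s + t)"
  by (simp add: monom_dvd_def lookup_add)

lemma monom_dvd_diff_add: "monom_dvd s t \<Longrightarrow> (t - s) + s = t"
  by (auto simp: monom_dvd_def lookup_add lookup_minus intro!: poly_mapping_eqI)

lemma monom_degree_mono: "monom_dvd s t \<Longrightarrow> monom_degree s \<le> monom_degree t"
  by (auto simp: monom_dvd_def monom_degree_def intro: sum_mono)

lemma monom_dvd_degree_eq:
  assumes "monom_dvd s t" "monom_degree s = monom_degree t"
  shows "s = t"
proof (rule poly_mapping_eqI)
  fix x
  show "lookup s x = lookup t x"
    using assms sum_mono_inv[of "lookup s" UNIV "lookup t" x]
    by (simp add: monom_dvd_def monom_degree_def)
qed

lemma monom_degree_add: "monom_degree (s + t) = monom_degree s + monom_degree t"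
  by (simp add: monom_degree_def lookup_add sum.distrib)

lemma monom_degree_zero [simp]: "monom_degree 0 = 0"
  by (simp add: monom_degree_def)

lemma monom_degree_eq_0D: "monom_degree t = 0 \<Longrightarrow> t = 0"
  using monom_dvd_degree_eq[of 0 t] by simp

lemma poly_mapping_sum_singles:
  "(\<Sum>t\<in>keys p. Poly_Mapping.single t (lookup p t)) = p" (is "?s = p")
proof (rule poly_mapping_eqI)
  fix w
  have "lookup ?s w = (\<Sum>t\<in>keys p. if t = w then lookup p t else 0)"
    by (auto simp: lookup_sum lookup_single when_def intro!: sum.cong)
  also have "\<dots> = lookup p w"
    by (simp add: in_keys_iff)
  finally show "lookup ?s w = lookup p w" .
qed

text \<open>The coefficient at \<open>w\<close> is a sum over the splittings
  \<open>w = r + s\<close> with \<open>r\<close> in the support of \<open>f\<close>, and the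
  hypothesis leaves only \<open>s = 0\<close>. It is met when \<open>w\<close> is 0, when
  \<open>w\<close> divides every monomial of \<open>f\<close>, and when \<open>f\<close> is
  homogeneous and \<open>w\<close> occurs in it.\<close>

lemma lookup_mult_minimal_key:
  fixes f g :: "('n, 'k::field) mpoly"
  assumes "\<And>r s. r \<in> keys f \<Longrightarrow> r + s = w \<Longrightarrow> s = 0"
  shows "lookup (f * g) w = lookup f w * lookup g 0"
proof -
  have "lookup f l * (\<Sum>q. lookup g q when w = l + q) = (lookup f l * lookup g 0 when l = w)" for l
  proof (cases "l \<in> keys f")
    case True
    have eq: "(lookup g q when w = l + q) = ((lookup g 0 when l = w) when q = 0)" for q
      using assms[OF True, of q] by (auto simp: when_def)
    show ?thesis
      unfolding eq by (simp add: when_def)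
  next
    case False
    then show ?thesis by (simp add: in_keys_iff)
  qed
  then show ?thesis
    by (simp add: lookup_mult)
qed

lemma lookup_mult_zero:
  fixes f g :: "('n, 'k::field) mpoly"
  shows "lookup (f * g) 0 = lookup f 0 * lookup g 0"
proof (rule lookup_mult_minimal_key)
  fix r s :: "'n monom"
  assume "r + s = 0"
  then show "s = 0" by (metis monom_dvd_add monom_dvd_zero_right)
qed

lemma keys_monom_poly [simp]: "keys (monom_poly t :: ('n, 'k::field) mpoly) = {t}"
  by (simp add: monom_poly_def)

text \<open>Adding a multiple of a generator preserves the condition on the terms; conversely each
  such term is itself a multiple of a generator. Ideal membership thereby becomes a question about
  exponent vectors.\<close>

lemma mem_monomial_ideal_iff:
  "p \<in> ideal_gen (monom_poly ` A) \<longleftrightarrow> (\<forall>t\<in>keys p. \<exists>a\<in>A. monom_dvd a t)"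
proof
  assume "p \<in> ideal_gen (monom_poly ` A)"
  then show "\<forall>t\<in>keys p. \<exists>a\<in>A. monom_dvd a t"
    unfolding ideal_gen_def
  proof (induction rule: Modules.module.span_induct_alt[OF module_times, consumes 1, case_names base step])
    case base
    then show ?case by simp
  next
    case (step c x y)
    then obtain a where a: "a \<in> A" "x = monom_poly a" by blast
    show ?case
    proof
      fix t assume "t \<in> keys (c * x + y)"
      then consider "t \<in> keys (c * x)" | "t \<in> keys y"
        using Poly_Mapping.keys_add[of "c * x" y] by blast
      then show "\<exists>a\<in>A. monom_dvd a t"
      proof cases
        case 1
        then obtain r where "t = r + a"
          using keys_mult[of c x] a(2) by (auto simp: monom_poly_def)
        then show ?thesis using a(1) monom_dvd_add by blast
      qed (use step in blast)
    qed
  qed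
next
  assume *: "\<forall>t\<in>keys p. \<exists>a\<in>A. monom_dvd a t"
  have "Poly_Mapping.single t (lookup p t) \<in> ideal_gen (monom_poly ` A)" if t: "t \<in> keys p" for t
  proof -
    obtain a where a: "a \<in> A" "monom_dvd a t" using * t by blast
    have "Poly_Mapping.single t (lookup p t) = Poly_Mapping.single (t - a) (lookup p t) * monom_poly a"
      by (simp add: monom_poly_def mult_single monom_dvd_diff_add[OF a(2)])
    then show ?thesis
      using a(1) unfolding ideal_gen_def
      by (metis Modules.module.span_base Modules.module.span_scale imageI module_times)
  qed
  then have "(\<Sum>t\<in>keys p. Poly_Mapping.single t (lookup p t)) \<in> ideal_gen (monom_poly ` A)"
    unfolding ideal_gen_def by (rule Modules.module.span_sum[OF module_times])
  then show "p \<in> ideal_gen (monom_poly ` A)"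
    by (simp add: poly_mapping_sum_singles)
qed

lemma monom_poly_mem_iff:
  "(monom_poly t :: ('n, 'k::field) mpoly) \<in> ideal_gen (monom_poly ` A) \<longleftrightarrow> (\<exists>a\<in>A. monom_dvd a t)"
  by (simp add: mem_monomial_ideal_iff)

lemma mem_principal_monomial_ideal_iff:
  "p \<in> ideal_gen {monom_poly u} \<longleftrightarrow> (\<forall>t\<in>keys p. monom_dvd u t)"
  using mem_monomial_ideal_iff[of p "{u}"] by simp

text \<open>Every monomial other than 1 is divisible by a variable. Minimality of a resolution thus
  says that the entries of its differentials have no constant term.\<close>

lemma mem_irrelevant_ideal_iff:
  fixes p :: "('n, 'k::field) mpoly"
  shows "p \<in> irrelevant_ideal \<longleftrightarrow> lookup p 0 = 0"
proof -
  have irr: "(irrelevant_ideal :: ('n, 'k) mpoly set) =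
      ideal_gen (monom_poly ` range (\<lambda>x. Poly_Mapping.single x 1))"
    by (simp add: irrelevant_ideal_def image_image)
  have "(\<exists>x. monom_dvd (Poly_Mapping.single x 1) t) \<longleftrightarrow> t \<noteq> 0" for t :: "'n monom"
  proof
    assume "\<exists>x. monom_dvd (Poly_Mapping.single x 1) t"
    then obtain x where "lookup (Poly_Mapping.single x 1) x \<le> lookup t x"
      unfolding monom_dvd_def by blast
    then show "t \<noteq> 0" by auto
  next
    assume "t \<noteq> 0"
    then obtain x where "lookup t x \<noteq> 0" by (metis lookup_zero poly_mapping_eqI)
    then have "monom_dvd (Poly_Mapping.single x 1) t"
      by (auto simp: monom_dvd_def lookup_single when_def)
    then show "\<exists>x. monom_dvd (Poly_Mapping.single x 1) t" ..
  qed
  then show ?thesis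
    by (auto simp: irr mem_monomial_ideal_iff in_keys_iff)
qed

section \<open>Minimal monomial generating sets\<close>

definition divisibility_antichain :: "'n monom set \<Rightarrow> bool" where
  "divisibility_antichain G \<longleftrightarrow> (\<forall>s\<in>G. \<forall>t\<in>G. monom_dvd s t \<longrightarrow> s = t)"

text \<open>Let \<open>H\<close> be any monomial generating set. A member \<open>g\<close> of
  \<open>G\<close> is divisible by some \<open>h\<close> in \<open>H\<close>, and \<open>h\<close>
  by some \<open>g'\<close> in \<open>G\<close>; the antichain property collapses this chain to
  \<open>g = h\<close>. So \<open>G\<close> lies in every such \<open>H\<close>, which gives both
  minimality and the uniqueness behind \<open>THE\<close>.\<close>

lemma min_monom_gens_eq:
  fixes M :: "('n, 'k::field) mpoly set"
  assumes M: "M = ideal_gen (monom_poly ` G)" and G: "divisibility_antichain G"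
  shows "min_monom_gens M = G"
proof -
  have sub: "G \<subseteq> H" if H: "ideal_gen (monom_poly ` H) = M" for H
  proof
    fix g assume g: "g \<in> G"
    then have "(monom_poly g :: ('n, 'k) mpoly) \<in> ideal_gen (monom_poly ` H)"
      unfolding H M using monom_poly_mem_iff monom_dvd_refl by blast
    then obtain h where h: "h \<in> H" "monom_dvd h g"
      unfolding monom_poly_mem_iff by blast
    have "(monom_poly h :: ('n, 'k) mpoly) \<in> ideal_gen (monom_poly ` G)"
      unfolding M[symmetric] H[symmetric] using h(1) monom_poly_mem_iff monom_dvd_refl by blast
    then obtain g' where g': "g' \<in> G" "monom_dvd g' h"
      unfolding monom_poly_mem_iff by blast
    then have "g' = g"
      using G g h(2) monom_dvd_trans unfolding divisibility_antichain_def by blast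
    then show "g \<in> H" using g' h monom_dvd_antisym by blast
  qed
  show ?thesis
    unfolding min_monom_gens_def
  proof (rule the_equality)
    show "is_min_monom_gens M G"
      unfolding is_min_monom_gens_def using M sub by blast
  next
    fix H assume "is_min_monom_gens M H"
    then show "H = G"
      unfolding is_min_monom_gens_def using M sub by blast
  qed
qed

text \<open>The divisibility-minimal members of a generating set generate the same ideal, because
  passing to a proper divisor lowers the degree and so must end.\<close>

lemma monomial_ideal_antichain:
  fixes M :: "('n::finite, 'k::field) mpoly set"
  assumes "monomial_ideal M"
  obtains G where "M = ideal_gen (monom_poly ` G)" "divisibility_antichain G"
proof -
  obtain A where A: "M = ideal_gen (monom_poly ` A)"
    using assms unfolding monomial_ideal_def by blast
  define G where "G = {a \<in> A. \<forall>b\<in>A. monom_dvd b a \<longrightarrow> b = a}"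
  have ex: "\<exists>g\<in>G. monom_dvd g a" if "a \<in> A" for a
    using that
  proof (induction "monom_degree a" arbitrary: a rule: less_induct)
    case less
    show ?case
    proof (cases "a \<in> G")
      case False
      then obtain b where b: "b \<in> A" "monom_dvd b a" "b \<noteq> a"
        using less.prems unfolding G_def by blast
      then have "monom_degree b < monom_degree a"
        using monom_degree_mono monom_dvd_degree_eq by (metis le_neq_implies_less)
      then show ?thesis using less.hyps b monom_dvd_trans by blast
    qed (use monom_dvd_refl in blast)
  qed
  have "(\<exists>a\<in>A. monom_dvd a t) \<longleftrightarrow> (\<exists>a\<in>G. monom_dvd a t)" for t
    using ex monom_dvd_trans G_def by blast
  then have "p \<in> ideal_gen (monom_poly ` A) \<longleftrightarrow> p \<in> ideal_gen (monom_poly ` G)" for p :: "('n, 'k) mpoly"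
    by (simp add: mem_monomial_ideal_iff)
  then have "ideal_gen (monom_poly ` A) = (ideal_gen (monom_poly ` G) :: ('n, 'k) mpoly set)"
    by blast
  moreover have "divisibility_antichain G"
    unfolding divisibility_antichain_def G_def by blast
  ultimately show thesis using that A by blast
qed

section \<open>The order of dominance\<close>

lemma dominance_sequence_nonempty:
  assumes "dominance_sequence G is"
  shows "G \<noteq> {}"
  using assms unfolding dominance_sequence_def by fastforce

text \<open>Bounds the set of lengths, so that its \<open>Sup\<close> in \<open>nat\<close> really
  is an upper bound.\<close>

lemma dominance_sequence_length_le:
  fixes "is" :: "'n::{finite,linorder} list"
  assumes "dominance_sequence G is"
  shows "length is \<le> card (UNIV :: 'n set)"
proof -
  have "distinct is"
    using assms unfolding dominance_sequence_def
    by (meson strict_sorted_iff)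
  then show ?thesis
    by (metis distinct_card card_mono finite subset_UNIV)
qed

text \<open>A single monomial is dominant in every variable and is its own least common multiple, so
  any one variable works; longer sequences would need several distinct generators.\<close>

lemma dominance_sequence_singleton_iff:
  "dominance_sequence {u} is \<longleftrightarrow> length is = 1"
proof
  assume "dominance_sequence {u} is"
  then obtain ds where ds: "length ds = length is" "distinct ds" "set ds \<subseteq> {u}" "is \<noteq> []"
    unfolding dominance_sequence_def by blast
  then have "length ds \<le> 1"
    by (metis card_mono distinct_card finite.emptyI finite.insertI is_singletonI is_singleton_altdef)
  then show "length is = 1" using ds by (cases "is") auto
next
  assume "length is = 1"
  then obtain x where "is = [x]" by (auto simp: length_Suc_conv)
  then show "dominance_sequence {u} is"
    by (auto simp: dominance_sequence_def dominant_set_def dominant_in_def lcm_exponent_def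
        intro!: exI[of _ "[u]"])
qed

lemma lcm_exponent_pair: "lcm_exponent {s, t} x = max (lookup s x) (lookup t x)"
  by (cases "s = t") (auto simp: lcm_exponent_def)

text \<open>The maxima are the exponents of the least common multiple, attained by \<open>d\<close>
  at \<open>x\<close> and by \<open>e\<close> at \<open>y\<close>. The last premise is therefore
  condition (ii) for this pair.\<close>

lemma dominance_sequence_pairI:
  assumes "d \<in> G" "e \<in> G" "x < y"
    and "lookup e x < lookup d x" "lookup d y < lookup e y"
    and "\<And>m. m \<in> G \<Longrightarrow> (\<And>z. lookup m z \<le> max (lookup d z) (lookup e z)) \<Longrightarrow>
           lookup d x \<le> lookup m x \<or> lookup e y \<le> lookup m y"
  shows "dominance_sequence G [x, y]"
  unfolding dominance_sequence_def
proof (intro conjI exI[of _ "[d, e]"])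
  have dom: "dominant_in {d, e} d x" "dominant_in {d, e} e y"
    using assms by (auto simp: dominant_in_def)
  then show "dominant_set (set [d, e])"
    by (auto simp: dominant_set_def)
  show "\<forall>j<length [x, y]. dominant_in (set [d, e]) ([d, e] ! j) ([x, y] ! j)"
    using dom by (auto simp: less_Suc_eq)
  show "\<forall>m\<in>G. (\<forall>z. lookup m z \<le> lcm_exponent (set [d, e]) z) \<longrightarrow>
      (\<exists>j<length [x, y]. lcm_exponent (set [d, e]) ([x, y] ! j) \<le> lookup m ([x, y] ! j))"
  proof (intro ballI impI)
    fix m assume "m \<in> G" "\<forall>z. lookup m z \<le> lcm_exponent (set [d, e]) z"
    then have "lookup d x \<le> lookup m x \<or> lookup e y \<le> lookup m y"
      using assms(6) by (simp add: lcm_exponent_pair)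
    then show "\<exists>j<length [x, y]. lcm_exponent (set [d, e]) ([x, y] ! j) \<le> lookup m ([x, y] ! j)"
    proof
      assume "lookup d x \<le> lookup m x"
      then show ?thesis using assms(4) by (intro exI[of _ 0]) (simp add: lcm_exponent_pair)
    next
      assume "lookup e y \<le> lookup m y"
      then show ?thesis using assms(5) by (intro exI[of _ 1]) (simp add: lcm_exponent_pair)
    qed
  qed
qed (use assms in auto)

lemma dominance_sequence_of_two_generators:
  fixes G :: "'n::{finite,linorder} monom set"
  assumes G: "divisibility_antichain G" and st: "s \<in> G" "t \<in> G" "s \<noteq> t"
  obtains "is" where "dominance_sequence G is" "length is = 2"
proof -
  \<comment> \<open>The degree of the least common multiple, to be minimised over the pairs of
    distinct generators; \<open>(s, t)\<close> shows that there is such a pair.\<close>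
  define lcm_deg where "lcm_deg = (\<lambda>(d, e). \<Sum>z\<in>UNIV. max (lookup d z) (lookup (e :: 'n monom) z))"
  define P where "P = (\<lambda>(d, e). d \<in> G \<and> e \<in> G \<and> d \<noteq> e)"
  obtain d e where P: "P (d, e)"
    and min: "\<And>q. P q \<Longrightarrow> lcm_deg (d, e) \<le> lcm_deg q"
    using ex_has_least_nat[of P "(s, t)" lcm_deg] st by (auto simp: P_def)
  have de: "d \<in> G" "e \<in> G" "d \<noteq> e" using P by (auto simp: P_def)
  have "\<not> monom_dvd d e" "\<not> monom_dvd e d"
    using G de unfolding divisibility_antichain_def by blast+
  then obtain x y where x: "lookup e x < lookup d x" and y: "lookup d y < lookup e y"
    unfolding monom_dvd_def by (meson not_le)
  \<comment> \<open>A generator dividing \<open>lcm(d, e)\<close> that violates condition (ii) could replace \<open>e\<close>, which would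
    decrease the \<open>y\<close>-exponent of the least common multiple.\<close>
  have cond: "lookup d x \<le> lookup m x \<or> lookup e y \<le> lookup m y"
    if m: "m \<in> G" "\<And>z. lookup m z \<le> max (lookup d z) (lookup e z)" for m
  proof (rule ccontr)
    assume "\<not> ?thesis"
    then have neg: "lookup m x < lookup d x" "lookup m y < lookup e y" by auto
    \<comment> \<open>The exponent of \<open>x\<close> separates \<open>m\<close> from
      \<open>d\<close>.\<close>
    then have "P (d, m)" using de m(1) by (auto simp: P_def)
    moreover have "lcm_deg (d, m) < lcm_deg (d, e)"
      unfolding lcm_deg_def prod.case
    proof (rule sum_strict_mono_ex1)
      show "\<forall>z\<in>UNIV. max (lookup d z) (lookup m z) \<le> max (lookup d z) (lookup e z)"
        using m(2) by simp
      show "\<exists>z\<in>UNIV. max (lookup d z) (lookup m z) < max (lookup d z) (lookup e z)"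
        using neg(2) y by (intro bexI[of _ y]) auto
    qed simp
    ultimately show False using min[of "(d, m)"] by simp
  qed
  have "x \<noteq> y" using x y by auto
  then consider "x < y" | "y < x" by fastforce
  then show thesis
  proof cases
    case 1
    then have "dominance_sequence G [x, y]"
      using de x y cond by (intro dominance_sequence_pairI[of d G e]) auto
    then show thesis using that by fastforce
  next
    case 2
    \<comment> \<open>Sequences must increase, so the generators swap roles along with the
      variables.\<close>
    then have "dominance_sequence G [y, x]"
      using de x y cond by (intro dominance_sequence_pairI[of e G d]) (auto simp: max.commute)
    then show thesis using that by fastforce
  qed
qed

text \<open>An empty \<open>G\<close> admits no sequence, two generators admit one of length 2, and
  a single generator admits length 1 only.\<close>

lemma odom_eq_1_iff:
  fixes M :: "('n::{finite,linorder}, 'k::field) mpoly set"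
  assumes M: "M = ideal_gen (monom_poly ` G)" and G: "divisibility_antichain G"
  shows "odom M = 1 \<longleftrightarrow> (\<exists>u. G = {u})"
proof
  let ?L = "{length is |is. dominance_sequence G is}"
  have odom: "odom M = Sup ?L"
    by (simp add: odom_def min_monom_gens_eq[OF M G])
  show "\<exists>u. G = {u}" if "odom M = 1"
  proof (rule ccontr)
    assume no: "\<nexists>u. G = {u}"
    \<comment> \<open>The supremum of the empty set of naturals is 0.\<close>
    have "?L \<noteq> {}"
      using that odom by (auto simp: Sup_nat_def split: if_splits)
    then obtain s where s: "s \<in> G"
      using dominance_sequence_nonempty by blast
    then obtain t where "t \<in> G" "s \<noteq> t"
      using no by blast
    then have "2 \<in> ?L"
      using dominance_sequence_of_two_generators[OF G s] by (metis (mono_tags, lifting) mem_Collect_eq)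
    moreover have "bdd_above ?L"
      using dominance_sequence_length_le by (auto intro!: bdd_aboveI[of _ "card (UNIV :: 'n set)"])
    ultimately have "2 \<le> Sup ?L"
      by (rule cSup_upper)
    then show False using that odom by simp
  qed
  show "odom M = 1" if "\<exists>u. G = {u}"
  proof -
    obtain u where u: "G = {u}" using \<open>\<exists>u. G = {u}\<close> ..
    have "?L = {1}"
    proof (intro equalityI subsetI)
      fix l :: nat assume "l \<in> {1}"
      \<comment> \<open>Here \<open>undefined\<close> is an arbitrary variable; there is one, since
        types are inhabited.\<close>
      then have "dominance_sequence G [undefined] \<and> l = length [undefined :: 'n]"
        by (simp add: u dominance_sequence_singleton_iff)
      then show "l \<in> ?L" by blast
    qed (auto simp: u dominance_sequence_singleton_iff)
    then show ?thesis by (simp add: odom)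
  qed
qed

section \<open>Minimal free resolutions\<close>

text \<open>A multiple of x^u of the same degree as x^u is x^u itself.\<close>

lemma single_if_homogeneous:
  assumes "homogeneous d p" "\<forall>t\<in>keys p. monom_dvd u t" "lookup p u \<noteq> 0"
  shows "p = Poly_Mapping.single u (lookup p u)"
proof (rule poly_mapping_eqI)
  fix t
  show "lookup p t = lookup (Poly_Mapping.single u (lookup p u)) t"
  proof (cases "t \<in> keys p")
    case True
    moreover have "u \<in> keys p" using assms(3) by (simp add: in_keys_iff)
    ultimately have "int (monom_degree u) = int (monom_degree t)"
      using assms(1) by (simp add: homogeneous_def)
    then have "u = t"
      using True assms(2) monom_dvd_degree_eq by auto
    then show ?thesis by simp
  next
    case False
    then show ?thesis using assms(3)
      by (auto simp: in_keys_iff lookup_single when_def)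
  qed
qed

lemma monom_dvd_factor:
  fixes p :: "('n, 'k::field) mpoly"
  assumes "\<forall>t\<in>keys p. monom_dvd u t"
  obtains q where "p = monom_poly u * q"
proof -
  have "p = (\<Sum>t\<in>keys p. monom_poly u * Poly_Mapping.single (t - u) (lookup p t))"
  proof -
    have "(\<Sum>t\<in>keys p. monom_poly u * Poly_Mapping.single (t - u) (lookup p t))
        = (\<Sum>t\<in>keys p. Poly_Mapping.single t (lookup p t))"
      using assms by (intro sum.cong) (simp_all add: monom_poly_def mult_single monom_dvd_diff_add add.commute[of u])
    then show ?thesis by (simp add: poly_mapping_sum_singles)
  qed
  also have "\<dots> = monom_poly u * (\<Sum>t\<in>keys p. Poly_Mapping.single (t - u) (lookup p t))"
    by (simp add: sum_distrib_left)
  finally show thesis by (rule that)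
qed

text \<open>If homogeneous multiples of \<open>x\<^sup>u\<close> generate an element with \<open>x\<^sup>u\<close> in its support, then one of them
  is a scalar multiple of \<open>x\<^sup>u\<close> and every further one yields a syzygy with a unit entry.\<close>

lemma minimal_generators_singleton:
  fixes a :: "('n::finite, 'k::field) mpoly vec"
  assumes a: "a \<in> carrier_vec b"
    and hom: "\<And>c. c < b \<Longrightarrow> homogeneous (\<mu> c) (a $ c)"
    and dvd: "\<And>c. c < b \<Longrightarrow> \<forall>t\<in>keys (a $ c). monom_dvd u t"
    and v: "v \<in> carrier_vec b" "lookup (a \<bullet> v) u \<noteq> 0"
    and syz: "\<And>w c. w \<in> carrier_vec b \<Longrightarrow> a \<bullet> w = 0 \<Longrightarrow> c < b \<Longrightarrow> lookup (w $ c) 0 = 0"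
  obtains k where "b = 1" "k \<noteq> 0" "a $ 0 = Poly_Mapping.single u k"
proof -
  have "(\<Sum>c<b. lookup (a $ c * v $ c) u) \<noteq> 0"
    using v by (simp add: scalar_prod_def lookup_sum atLeast0LessThan)
  \<comment> \<open>Some single product contributes to the coefficient of x^u. As all monomials of
    \<open>a $ i\<close> are multiples of x^u, this contribution comes from x^u in
    \<open>a $ i\<close> and the constant term of \<open>v $ i\<close>.\<close>
  then obtain i where i: "i < b" "lookup (a $ i * v $ i) u \<noteq> 0"
    by (metis (no_types, lifting) lessThan_iff sum.neutral)
  have "lookup (a $ i * v $ i) u = lookup (a $ i) u * lookup (v $ i) 0"
  proof (rule lookup_mult_minimal_key)
    fix r s assume r: "r \<in> keys (a $ i)" and rs: "r + s = u"
    have "monom_degree u \<le> monom_degree r" using dvd i(1) r monom_degree_mono by blast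
    then have "monom_degree s = 0" using rs monom_degree_add[of r s] by simp
    then show "s = 0" by (rule monom_degree_eq_0D)
  qed
  then have k: "lookup (a $ i) u \<noteq> 0" using i(2) by auto
  define k where "k = lookup (a $ i) u"
  have ai: "a $ i = Poly_Mapping.single u k"
    unfolding k_def using hom dvd i(1) k by (intro single_if_homogeneous) auto
  have only: "j = i" if j: "j < b" for j
  proof (rule ccontr)
    assume ne: "j \<noteq> i"
    obtain q where q: "a $ j = monom_poly u * q"
      using monom_dvd_factor dvd[OF j] by blast
    \<comment> \<open>Since x^u is \<open>a $ i\<close> divided by \<open>k\<close>, also
      \<open>a $ j\<close> is a multiple of \<open>a $ i\<close>; \<open>w\<close> is the resulting
      syzygy, with entry 1 at \<open>j\<close>.\<close>
    define w where "w = unit_vec b j + (- Poly_Mapping.single 0 (1 / k) * q) \<cdot>\<^sub>v unit_vec b i"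
    have w: "w \<in> carrier_vec b" by (simp add: w_def)
    have "a \<bullet> w = a $ j - Poly_Mapping.single 0 (1 / k) * q * a $ i"
      using a i(1) j
      by (simp add: w_def scalar_prod_add_distrib[of _ b] scalar_prod_smult_distrib[of _ b]
          scalar_prod_right_unit)
    also have "Poly_Mapping.single 0 (1 / k) * q * a $ i = (Poly_Mapping.single 0 (1 / k) * Poly_Mapping.single u k) * q"
      by (simp add: ai mult_ac)
    also have "\<dots> = a $ j"
      using k by (simp add: mult_single q monom_poly_def k_def)
    finally have "lookup (w $ j) 0 = 0"
      using syz w j by simp
    moreover have "w $ j = 1" using i(1) j ne by (simp add: w_def)
    ultimately show False by simp
  qed
  have i0: "i = 0" using only[of 0] i(1) by simp
  moreover have "b = 1" using only[of 1] i(1) i0 by (cases "1 < b") auto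
  ultimately show thesis using that ai k k_def by simp
qed

text \<open>Constant terms are additive and multiplicative. Combined with exactness, this is how
  minimality enters: no vector in the kernel of a differential has an entry with a constant
  term.\<close>

lemma mat_im_subset_irrelevant:
  fixes A :: "('n, 'k::field) mpoly mat"
  assumes "A \<in> carrier_mat n m" "\<And>r c. r < n \<Longrightarrow> c < m \<Longrightarrow> A $$ (r, c) \<in> irrelevant_ideal"
    and "v \<in> mat_im A" "r < n"
  shows "lookup (v $ r) 0 = 0"
proof -
  obtain w where w: "w \<in> carrier_vec m" "v = A *\<^sub>v w"
    using assms(1,3) by (auto simp: mat_im_def)
  then have "v $ r = (\<Sum>c<m. A $$ (r, c) * w $ c)"
    using assms(1,4) by (simp add: scalar_prod_def atLeast0LessThan)
  then show ?thesis
    using assms(2,4) by (simp add: lookup_sum lookup_mult_zero mem_irrelevant_ideal_iff)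
qed

lemma minimal_free_resolutionD:
  assumes "minimal_free_resolution M b \<mu> \<epsilon> D"
  shows "\<epsilon> \<in> carrier_vec (b 0)"
    and "D (Suc i) \<in> carrier_mat (b i) (b (Suc i))"
    and "c < b 0 \<Longrightarrow> homogeneous (\<mu> 0 c) (\<epsilon> $ c)"
    and "r < b i \<Longrightarrow> c < b (Suc i) \<Longrightarrow> homogeneous (\<mu> (Suc i) c - \<mu> i r) (D (Suc i) $$ (r, c))"
    and "\<exists>v \<in> carrier_vec (b 0). f - \<epsilon> \<bullet> v \<in> M"
    and "{v \<in> carrier_vec (b 0). \<epsilon> \<bullet> v \<in> M} = mat_im (D 1)"
    and "mat_ker (D (Suc i)) = mat_im (D (Suc (Suc i)))"
    and "r < b i \<Longrightarrow> c < b (Suc i) \<Longrightarrow> D (Suc i) $$ (r, c) \<in> irrelevant_ideal"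
  using assms unfolding minimal_free_resolution_def graded_free_resolution_def by blast+

text \<open>If the differential vanishes, a basis vector would be a cycle, hence a boundary by
  exactness; but its entry 1 has a constant term.\<close>

lemma minimal_resolution_rank_0_if_differential_0:
  fixes M :: "('n::finite, 'k::field) mpoly set"
  assumes res: "minimal_free_resolution M b \<mu> \<epsilon> D"
    and zero: "\<And>v. v \<in> carrier_vec (b (Suc i)) \<Longrightarrow> D (Suc i) *\<^sub>v v = 0\<^sub>v (b i)"
  shows "b (Suc i) = 0"
proof (rule ccontr)
  assume "b (Suc i) \<noteq> 0"
  then have pos: "0 < b (Suc i)" by simp
  note res' = minimal_free_resolutionD[OF res]
  have carr: "D (Suc i) \<in> carrier_mat (b i) (b (Suc i))"
    "D (Suc (Suc i)) \<in> carrier_mat (b (Suc i)) (b (Suc (Suc i)))"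
    by (rule res'(2))+
  then have "unit_vec (b (Suc i)) 0 \<in> mat_ker (D (Suc i))"
    using zero by (simp add: mat_ker_def)
  then have "unit_vec (b (Suc i)) 0 \<in> mat_im (D (Suc (Suc i)))"
    using res'(7) by blast
  then have "lookup (unit_vec (b (Suc i)) 0 $ 0 :: ('n, 'k) mpoly) 0 = 0"
    by (intro mat_im_subset_irrelevant[OF carr(2) _ _ pos] res'(8))
  then show False using pos by simp
qed

lemma ideal_gen_mult: "p \<in> ideal_gen A \<Longrightarrow> q * p \<in> ideal_gen A"
  unfolding ideal_gen_def by (rule Modules.module.span_scale[OF module_times])

text \<open>Only the generator 1 divides the monomial 1, and it would generate the whole
  ring.\<close>

lemma proper_monomial_ideal_constant_term:
  fixes M :: "('n, 'k::field) mpoly set"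
  assumes "M = ideal_gen (monom_poly ` G)" "M \<noteq> UNIV" "p \<in> M"
  shows "lookup p 0 = 0"
proof (rule ccontr)
  assume "lookup p 0 \<noteq> 0"
  then have "0 \<in> keys p" by (simp add: in_keys_iff)
  then obtain g where "g \<in> G" "monom_dvd g 0"
    using assms(1,3) mem_monomial_ideal_iff by blast
  then have "0 \<in> G" using monom_dvd_zero_right by blast
  then have "p \<in> M" for p
    unfolding assms(1) mem_monomial_ideal_iff using monom_dvd_zero by blast
  then show False using assms(2) by blast
qed

text \<open>The augmentation reaches the class of 1, so one of its entries is a unit and minimality
  excludes any other. Up to this unit, the image of \<open>D 1\<close> is then
  \<open>M\<close>.\<close>

lemma minimal_resolution_start:
  fixes M :: "('n::finite, 'k::field) mpoly set"
  assumes M: "M = ideal_gen (monom_poly ` G)" "M \<noteq> UNIV"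
    and res: "minimal_free_resolution M b \<mu> \<epsilon> D"
  shows "b 0 = 1" and "vec 1 (\<lambda>_. p) \<in> mat_im (D 1) \<longleftrightarrow> p \<in> M"
proof -
  note res' = minimal_free_resolutionD[OF res]
  have eps: "\<epsilon> \<in> carrier_vec (b 0)" and D1: "D 1 \<in> carrier_mat (b 0) (b 1)"
    and ker: "{v \<in> carrier_vec (b 0). \<epsilon> \<bullet> v \<in> M} = mat_im (D 1)"
    and min: "\<And>r c. r < b 0 \<Longrightarrow> c < b 1 \<Longrightarrow> D 1 $$ (r, c) \<in> irrelevant_ideal"
    using res'(1) res'(2)[of 0] res'(6) res'(8)[of _ 0] by simp_all
  have "0 \<in> M" using M(1) by (simp add: mem_monomial_ideal_iff)
  obtain v where v: "v \<in> carrier_vec (b 0)" "1 - \<epsilon> \<bullet> v \<in> M"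
    using res'(5) by blast
  have nz: "lookup (\<epsilon> \<bullet> v) 0 \<noteq> 0"
    using proper_monomial_ideal_constant_term[OF M v(2)] by (simp add: lookup_minus)
  have syz: "lookup (w $ c) 0 = 0" if "w \<in> carrier_vec (b 0)" "\<epsilon> \<bullet> w = 0" "c < b 0" for w c
  proof (rule mat_im_subset_irrelevant[OF D1 min _ that(3)])
    show "w \<in> mat_im (D 1)" using that(1,2) \<open>0 \<in> M\<close> unfolding ker[symmetric] by simp
  qed
  \<comment> \<open>The case \<open>u = 0\<close>, where divisibility by x^u holds
    trivially.\<close>
  obtain k where b0: "b 0 = 1" and k: "k \<noteq> 0" "\<epsilon> $ 0 = Poly_Mapping.single 0 k"
    by (rule minimal_generators_singleton[OF eps res'(3) _ v(1) nz syz]) simp_all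
  show "b 0 = 1" by (rule b0)
  have "\<epsilon> \<bullet> vec 1 (\<lambda>_. p) = Poly_Mapping.single 0 k * p"
    using b0 k by (simp add: scalar_prod_def)
  moreover have "Poly_Mapping.single 0 k * p \<in> M \<longleftrightarrow> p \<in> M"
  proof
    assume "Poly_Mapping.single 0 k * p \<in> M"
    \<comment> \<open>The scalar \<open>k\<close> is cancelled by its inverse.\<close>
    then have "Poly_Mapping.single 0 (1 / k) * (Poly_Mapping.single 0 k * p) \<in> M"
      unfolding M(1) by (rule ideal_gen_mult)
    then show "p \<in> M" using k by (simp add: mult.assoc[symmetric] mult_single)
  qed (simp add: M(1) ideal_gen_mult)
  ultimately show "vec 1 (\<lambda>_. p) \<in> mat_im (D 1) \<longleftrightarrow> p \<in> M"
    using b0 unfolding ker[symmetric] by simp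
qed

section \<open>Matrices with one row or without columns\<close>

lemma mat_im_row:
  assumes "A \<in> carrier_mat 1 m"
  shows "vec 1 (\<lambda>_. p) \<in> mat_im A \<longleftrightarrow> (\<exists>v\<in>carrier_vec m. p = row A 0 \<bullet> v)"
proof -
  have "vec 1 (\<lambda>_. p) = A *\<^sub>v v \<longleftrightarrow> p = row A 0 \<bullet> v" for v
    using assms by (auto simp: vec_eq_iff)
  then show ?thesis using assms by (auto simp: mat_im_def)
qed

lemma mat_ker_row:
  assumes "A \<in> carrier_mat 1 m"
  shows "v \<in> mat_ker A \<longleftrightarrow> v \<in> carrier_vec m \<and> row A 0 \<bullet> v = 0"
proof -
  have "A *\<^sub>v v = 0\<^sub>v 1 \<longleftrightarrow> row A 0 \<bullet> v = 0" for v
    using assms by (auto simp: vec_eq_iff)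
  then show ?thesis using assms by (auto simp: mat_ker_def)
qed

lemma mult_mat_vec_no_cols:
  assumes "A \<in> carrier_mat n 0" "v \<in> carrier_vec 0"
  shows "A *\<^sub>v v = 0\<^sub>v n"
proof (rule eq_vecI)
  fix i assume "i < dim_vec (0\<^sub>v n :: 'a vec)"
  then show "(A *\<^sub>v v) $ i = 0\<^sub>v n $ i"
    using assms by (simp add: scalar_prod_def)
qed (use assms in simp)

lemma mat_im_no_cols: "A \<in> carrier_mat n 0 \<Longrightarrow> mat_im A = {0\<^sub>v n}"
  using mult_mat_vec_no_cols[of A n] by (auto simp: mat_im_def intro: image_eqI[of _ _ "0\<^sub>v 0"])

lemma mat_ker_no_cols:
  assumes "A \<in> carrier_mat n 0"
  shows "mat_ker A = {0\<^sub>v 0}"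
proof -
  have "mat_ker A = carrier_vec 0"
    using assms mult_mat_vec_no_cols[OF assms] by (auto simp: mat_ker_def)
  also have "\<dots> = {0\<^sub>v 0}"
    by (auto intro: eq_vecI)
  finally show ?thesis .
qed

section \<open>Principal ideals and their resolutions\<close>

text \<open>Injectivity of \<open>D 1\<close> leaves a single homogeneous generator
  \<open>f\<close>. A monomial x^u of \<open>f\<close> lies in the monomial ideal \<open>M\<close>,
  so it is a multiple of \<open>f\<close>, which makes \<open>f\<close> a scalar times x^u.\<close>

lemma principal_if_rank_2_zero:
  fixes M :: "('n::finite, 'k::field) mpoly set"
  assumes M: "M = ideal_gen (monom_poly ` G)" "M \<noteq> UNIV"
    and res: "minimal_free_resolution M b \<mu> \<epsilon> D" and b: "b 1 \<noteq> 0" "b 2 = 0"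
  obtains u where "M = ideal_gen (monom_poly ` {u})"
proof -
  note res' = minimal_free_resolutionD[OF res]
  note start = minimal_resolution_start[OF M res]
  have D: "D 1 \<in> carrier_mat 1 (b 1)" "D 2 \<in> carrier_mat (b 1) 0"
    using res'(2)[of 0] res'(2)[of 1] start(1) b(2) by (simp_all add: numeral_2_eq_2)
  define a where "a = row (D 1) 0"
  have a: "a \<in> carrier_vec (b 1)" unfolding a_def using D(1) by (intro row_carrier_vec) auto
  have "mat_ker (D 1) = mat_im (D 2)"
    using res'(7)[of 0] by (simp add: numeral_2_eq_2)
  also have "\<dots> = {0\<^sub>v (b 1)}"
    by (rule mat_im_no_cols[OF D(2)])
  finally have inj: "v = 0\<^sub>v (b 1)" if "v \<in> carrier_vec (b 1)" "a \<bullet> v = 0" for v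
    using that mat_ker_row[OF D(1)] a_def by blast
  have nz: "a $ i \<noteq> 0" if "i < b 1" for i
  proof
    assume "a $ i = 0"
    then have "unit_vec (b 1) i = (0\<^sub>v (b 1) :: ('n, 'k) mpoly vec)"
      using that a by (intro inj) (auto simp: scalar_prod_right_unit)
    then have "unit_vec (b 1) i $ i = (0\<^sub>v (b 1) $ i :: ('n, 'k) mpoly)" by simp
    then show False using that by simp
  qed
  have b1: "b 1 = 1"
  proof (rule ccontr)
    assume "b 1 \<noteq> 1"
    then have "1 < b 1" using b by simp
    \<comment> \<open>The Koszul relation between the first two entries.\<close>
    define w where "w = a $ 1 \<cdot>\<^sub>v unit_vec (b 1) 0 + (- a $ 0) \<cdot>\<^sub>v unit_vec (b 1) 1"
    have "a \<bullet> w = 0"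
      using a \<open>1 < b 1\<close>
      by (simp add: w_def scalar_prod_add_distrib[of _ "b 1"] scalar_prod_smult_distrib[of _ "b 1"]
          scalar_prod_right_unit)
    then have "w = 0\<^sub>v (b 1)" by (intro inj) (simp_all add: w_def)
    then have "w $ 0 = 0" using \<open>1 < b 1\<close> by simp
    then have "a $ 1 = 0" using \<open>1 < b 1\<close> by (simp add: w_def)
    then show False using nz \<open>1 < b 1\<close> by simp
  qed
  define f where "f = a $ 0"
  have mem: "p \<in> M \<longleftrightarrow> (\<exists>g. p = f * g)" for p
  proof -
    have "p \<in> M \<longleftrightarrow> (\<exists>v\<in>carrier_vec 1. p = a \<bullet> v)"
      using start(2)[of p] mat_im_row[OF D(1), of p] b1 by (simp add: a_def)
    also have "\<dots> \<longleftrightarrow> (\<exists>g. p = f * g)"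
    proof
      assume "\<exists>g. p = f * g"
      then obtain g where "p = f * g" ..
      then have "p = a \<bullet> vec 1 (\<lambda>_. g)" by (simp add: scalar_prod_def f_def)
      then show "\<exists>v\<in>carrier_vec 1. p = a \<bullet> v" by (metis vec_carrier)
    qed (auto simp: scalar_prod_def f_def)
    finally show ?thesis .
  qed
  have hom: "homogeneous (\<mu> 1 0 - \<mu> 0 0) f"
  proof -
    have "homogeneous (\<mu> (Suc 0) 0 - \<mu> 0 0) (D (Suc 0) $$ (0, 0))"
      using res'(4)[of 0 0 0] start(1) b1 by simp
    then show ?thesis using D(1) b1 by (simp add: f_def a_def)
  qed
  have "f \<noteq> 0" using nz b1 by (simp add: f_def)
  then obtain u where u: "u \<in> keys f" by fastforce
  have "f \<in> M" using mem[of f] by (metis mult_1_right)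
  then have "monom_poly u \<in> M"
    using u unfolding M(1) mem_monomial_ideal_iff by simp
  then obtain g where g: "monom_poly u = f * g" using mem by blast
  \<comment> \<open>By homogeneity no monomial of \<open>f\<close> properly divides another, so on
    the support of \<open>f\<close> the product with \<open>g\<close> only rescales by the constant
    term of \<open>g\<close>.\<close>
  have coeff: "lookup (f * g) t = lookup f t * lookup g 0" if t: "t \<in> keys f" for t
  proof (rule lookup_mult_minimal_key)
    fix r s assume "r \<in> keys f" and rs: "r + s = t"
    then have "int (monom_degree r) = int (monom_degree t)" using hom t by (simp add: homogeneous_def)
    then show "s = 0" using rs monom_degree_add[of r s] by (simp add: monom_degree_eq_0D)
  qed
  have g0: "lookup g 0 \<noteq> 0"
    using coeff[OF u] g by (metis in_keys_iff insertI1 keys_monom_poly mult_zero_right)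
  have key: "t = u" if t: "t \<in> keys f" for t
  proof -
    have "t \<in> keys (f * g)" using t coeff[OF t] g0 by (simp add: in_keys_iff)
    then show ?thesis using g by (metis keys_monom_poly singletonD)
  qed
  have "M = ideal_gen (monom_poly ` {u})"
  proof (intro equalityI subsetI)
    fix p assume "p \<in> M"
    then obtain h where "p = f * h" using mem by blast
    then have "\<forall>t\<in>keys p. monom_dvd u t"
      using keys_mult[of f h] key monom_dvd_add by (fastforce simp: add.commute)
    then show "p \<in> ideal_gen (monom_poly ` {u})" by (simp add: mem_principal_monomial_ideal_iff)
  next
    fix p :: "('n, 'k) mpoly" assume "p \<in> ideal_gen (monom_poly ` {u})"
    then have "\<forall>t\<in>keys p. monom_dvd u t" by (simp add: mem_principal_monomial_ideal_iff)
    then obtain q where "p = monom_poly u * q" using monom_dvd_factor by blast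
    then show "p \<in> M" using g mem by (metis mult.assoc)
  qed
  then show thesis by (rule that)
qed

text \<open>The row \<open>D 1\<close> reduces to one nonzero scalar multiple of x^u and is
  injective, since the polynomial ring is a domain. Hence \<open>D 2\<close> is zero, and the ranks
  vanish one after another.\<close>

lemma principal_resolution_ranks:
  fixes M :: "('n::{finite,linorder}, 'k::field) mpoly set"
  assumes M: "M = ideal_gen (monom_poly ` {u})" "M \<noteq> UNIV"
    and res: "minimal_free_resolution M b \<mu> \<epsilon> D"
  shows "b (Suc (Suc i)) = 0"
proof -
  note res' = minimal_free_resolutionD[OF res]
  note start = minimal_resolution_start[OF M res]
  have carr: "D (Suc j) \<in> carrier_mat (b j) (b (Suc j))" for j
    by (rule res'(2))
  have D1: "D 1 \<in> carrier_mat 1 (b 1)"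
    using carr[of 0] start(1) by simp
  define a where "a = row (D 1) 0"
  have a: "a \<in> carrier_vec (b 1)" unfolding a_def using D1 by (intro row_carrier_vec) auto
  have mem: "p \<in> M \<longleftrightarrow> (\<exists>v\<in>carrier_vec (b 1). p = a \<bullet> v)" for p
    using start(2)[of p] mat_im_row[OF D1, of p] by (simp add: a_def)
  have "monom_poly u \<in> M" using M(1) by (simp add: mem_principal_monomial_ideal_iff)
  then obtain v where v: "v \<in> carrier_vec (b 1)" "monom_poly u = a \<bullet> v" using mem by blast
  have ker: "mat_ker (D 1) = mat_im (D 2)"
    using res'(7)[of 0] by (simp add: numeral_2_eq_2)
  obtain k where b1: "b 1 = 1" and k: "k \<noteq> 0" "a $ 0 = Poly_Mapping.single u k"
  proof (rule minimal_generators_singleton[OF a _ _ v(1), of "\<lambda>c. \<mu> 1 c - \<mu> 0 0" u])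
    fix c assume c: "c < b 1"
    have "homogeneous (\<mu> (Suc 0) c - \<mu> 0 0) (D (Suc 0) $$ (0, c))"
      using res'(4)[of 0 0 c] start(1) c by simp
    then show "homogeneous (\<mu> 1 c - \<mu> 0 0) (a $ c)" using D1 c by (simp add: a_def)
    \<comment> \<open>Each entry of the row is the image of a basis vector.\<close>
    have "a $ c \<in> M"
      unfolding mem using a c by (intro bexI[of _ "unit_vec (b 1) c"]) (auto simp: scalar_prod_right_unit)
    then show "\<forall>t\<in>keys (a $ c). monom_dvd u t" using M(1) by (simp add: mem_principal_monomial_ideal_iff)
  next
    show "lookup (a \<bullet> v) u \<noteq> 0" by (simp add: v(2)[symmetric] monom_poly_def)
  next
    fix w c assume w: "w \<in> carrier_vec (b 1)" "a \<bullet> w = 0" and c: "c < b 1"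
    have "w \<in> mat_im (D (Suc 1))"
      using w mat_ker_row[OF D1, of w] ker by (simp add: a_def numeral_2_eq_2)
    then show "lookup (w $ c) 0 = 0"
      using c by (intro mat_im_subset_irrelevant[OF carr[of 1]] res'(8)) simp_all
  qed
  have inj: "w = 0\<^sub>v 1" if "w \<in> mat_ker (D 1)" for w
  proof -
    have w: "w \<in> carrier_vec 1" "a \<bullet> w = 0"
      using that mat_ker_row[OF D1, of w] b1 by (simp_all add: a_def)
    then have "Poly_Mapping.single u k * w $ 0 = 0" using k by (simp add: scalar_prod_def)
    moreover have "Poly_Mapping.single u k \<noteq> 0"
      using k(1) by (metis lookup_single_eq lookup_zero)
    ultimately have "w $ 0 = 0" by simp
    then show ?thesis using w(1) by (auto simp: vec_eq_iff)
  qed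
  show ?thesis
  proof (induction i)
    case 0
    show ?case
    proof (rule minimal_resolution_rank_0_if_differential_0[OF res])
      fix v :: "('n, 'k) mpoly vec" assume "v \<in> carrier_vec (b (Suc (Suc 0)))"
      then have "D (Suc (Suc 0)) *\<^sub>v v \<in> mat_im (D 2)"
        using carr[of 1] by (auto simp: mat_im_def numeral_2_eq_2)
      then show "D (Suc (Suc 0)) *\<^sub>v v = 0\<^sub>v (b (Suc 0))"
        using ker inj b1 by simp
    qed
  next
    case (Suc i)
    \<comment> \<open>The differential maps into a module of rank 0.\<close>
    show ?case
      using carr[of "Suc (Suc i)"] Suc
      by (intro minimal_resolution_rank_0_if_differential_0[OF res]) (auto simp: vec_eq_iff)
  qed
qed

text \<open>Multiplication by x^u from S, shifted by the degree of u, to S is the whole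
  resolution.\<close>

lemma principal_has_betti_1:
  fixes M :: "('n::{finite,linorder}, 'k::field) mpoly set"
  assumes M: "M = ideal_gen (monom_poly ` {u})" "M \<noteq> UNIV"
  shows "has_betti M 1 1"
proof -
  define b where "b = (\<lambda>i :: nat. if i \<le> 1 then 1 else 0 :: nat)"
  define \<mu> where "\<mu> = (\<lambda>(i :: nat) (c :: nat). if i = 0 then 0 else int (monom_degree u))"
  define \<epsilon> where "\<epsilon> = vec 1 (\<lambda>_. 1 :: ('n, 'k) mpoly)"
  \<comment> \<open>From \<open>D 2\<close> on these matrices have no columns.\<close>
  define D where "D = (\<lambda>i. mat (b (i - 1)) (b i) (\<lambda>_. monom_poly u :: ('n, 'k) mpoly))"
  \<comment> \<open>This puts the entry x^u of \<open>D 1\<close> into the irrelevant ideal.\<close>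
  have u: "u \<noteq> 0"
  proof
    assume "u = 0"
    then have "M = UNIV" using M(1) by (auto simp: mem_principal_monomial_ideal_iff)
    then show False using M(2) by simp
  qed
  have b: "b 0 = 1" "b (Suc 0) = 1" "b (Suc (Suc i)) = 0" for i
    by (simp_all add: b_def)
  have D: "D (Suc i) \<in> carrier_mat (b i) (b (Suc i))" for i
    by (simp add: D_def)
  have D1: "D 1 \<in> carrier_mat 1 1" and row: "row (D 1) 0 = vec 1 (\<lambda>_. monom_poly u)"
    by (auto simp: D_def b vec_eq_iff)
  have hom: "homogeneous (\<mu> (Suc i) c - \<mu> i r) (D (Suc i) $$ (r, c))" if "r < b i" "c < b (Suc i)" for i r c
    using that by (cases i) (auto simp: D_def b \<mu>_def homogeneous_def)
  have vec1: "v = vec 1 (\<lambda>_. v $ 0)" if "v \<in> carrier_vec 1" for v :: "('n, 'k) mpoly vec"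
    using that by (auto simp: vec_eq_iff)
  have eps: "\<epsilon> \<bullet> v = v $ 0" if "v \<in> carrier_vec 1" for v
    using that by (simp add: \<epsilon>_def scalar_prod_def)
  have mul: "row (D 1) 0 \<bullet> v = monom_poly u * v $ 0" if "v \<in> carrier_vec 1" for v
    using that unfolding row by (simp add: scalar_prod_def)
  have mem: "p \<in> M \<longleftrightarrow> (\<exists>v\<in>carrier_vec 1. p = row (D 1) 0 \<bullet> v)" for p
  proof
    assume "p \<in> M"
    then have "\<forall>t\<in>keys p. monom_dvd u t" using M(1) by (simp add: mem_principal_monomial_ideal_iff)
    then obtain q where "p = monom_poly u * q" using monom_dvd_factor by blast
    then show "\<exists>v\<in>carrier_vec 1. p = row (D 1) 0 \<bullet> v"
      by (intro bexI[of _ "vec 1 (\<lambda>_. q)"]) (simp_all add: mul del: One_nat_def)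
  next
    assume "\<exists>v\<in>carrier_vec 1. p = row (D 1) 0 \<bullet> v"
    then obtain v where "p = v $ 0 * monom_poly u" by (auto simp: mul mult.commute simp del: One_nat_def)
    moreover have "monom_poly u \<in> M" using M(1) by (simp add: mem_principal_monomial_ideal_iff)
    ultimately show "p \<in> M" using M(1) ideal_gen_mult by blast
  qed
  have im1: "{v \<in> carrier_vec (b 0). \<epsilon> \<bullet> v \<in> M} = mat_im (D 1)"
  proof (rule Set.set_eqI)
    fix v :: "('n, 'k) mpoly vec"
    show "v \<in> {v \<in> carrier_vec (b 0). \<epsilon> \<bullet> v \<in> M} \<longleftrightarrow> v \<in> mat_im (D 1)"
    proof (cases "v \<in> carrier_vec 1")
      case True
      then show ?thesis
        using mat_im_row[OF D1, of "v $ 0"] mem[of "v $ 0"] vec1[OF True] eps[OF True] by (simp add: b)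
    next
      case False
      then show ?thesis using D1 by (auto simp: mat_im_def b)
    qed
  qed
  have exact: "mat_ker (D (Suc i)) = mat_im (D (Suc (Suc i)))" for i
  proof (cases i)
    case 0
    have "mat_ker (D 1) = {0\<^sub>v 1}"
    proof -
      have "monom_poly u \<noteq> (0 :: ('n, 'k) mpoly)"
        by (metis keys_monom_poly keys_zero insert_not_empty)
      then have "v \<in> mat_ker (D 1) \<longleftrightarrow> v = 0\<^sub>v 1" for v
      proof (cases "v \<in> carrier_vec 1")
        case True
        then have "v = 0\<^sub>v 1 \<longleftrightarrow> v $ 0 = 0" by (auto simp: vec_eq_iff)
        then show ?thesis
          using True \<open>monom_poly u \<noteq> 0\<close> by (simp add: mat_ker_row[OF D1] mul del: One_nat_def)
      next
        case False
        then show ?thesis using mat_ker_row[OF D1, of v] by auto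
      qed
      then show ?thesis by blast
    qed
    also have "\<dots> = mat_im (D (Suc 1))"
      using mat_im_no_cols[of "D (Suc 1)" 1] D[of 1] by (simp add: b)
    finally show ?thesis using 0 by simp
  next
    case (Suc j)
    have "mat_ker (D (Suc i)) = {0\<^sub>v 0}"
      using D[of i] by (intro mat_ker_no_cols[of _ "b i"]) (simp add: Suc b)
    moreover have "mat_im (D (Suc (Suc i))) = {0\<^sub>v 0}"
      using D[of "Suc i"] by (intro mat_im_no_cols) (simp add: Suc b)
    ultimately show ?thesis by simp
  qed
  have surj: "\<exists>v\<in>carrier_vec (b 0). f - \<epsilon> \<bullet> v \<in> M" for f
    using M(1) by (intro bexI[of _ "vec 1 (\<lambda>_. f)"]) (simp_all add: b eps mem_principal_monomial_ideal_iff)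
  have "graded_free_resolution M b \<mu> \<epsilon> D"
    unfolding graded_free_resolution_def
    using D hom im1 exact surj
    by (auto simp: \<epsilon>_def b \<mu>_def homogeneous_def)
  moreover have "D (Suc i) $$ (r, c) \<in> irrelevant_ideal" if "r < b i" "c < b (Suc i)" for i r c
    using that u by (simp add: D_def mem_irrelevant_ideal_iff monom_poly_def lookup_single when_def)
  ultimately have "minimal_free_resolution M b \<mu> \<epsilon> D"
    unfolding minimal_free_resolution_def by blast
  then show ?thesis unfolding has_betti_def using b(2) by auto
qed

lemma proj_dim_eq_1_iff:
  fixes M :: "('n::{finite,linorder}, 'k::field) mpoly set"
  assumes M: "M = ideal_gen (monom_poly ` G)" "M \<noteq> UNIV"
  shows "proj_dim M = 1 \<longleftrightarrow> (\<exists>u. M = ideal_gen (monom_poly ` {u}))"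
proof
  let ?B = "{enat i |i. \<exists>r. has_betti M i r \<and> r \<noteq> 0}"
  assume "proj_dim M = 1"
  then have Sup: "Sup ?B = 1" by (simp add: proj_dim_def)
  have le: "x \<le> 1" if "x \<in> ?B" for x
    using Sup_upper[OF that] unfolding Sup .
  \<comment> \<open>The supremum is attained: without 1, only 0 could remain in the set.\<close>
  have "1 \<in> ?B"
  proof (rule ccontr)
    assume "1 \<notin> ?B"
    have "x \<le> 0" if "x \<in> ?B" for x
    proof -
      have "x \<noteq> 1" using that \<open>1 \<notin> ?B\<close> by blast
      then have "x < 1" using le[OF that] by (rule order_neq_le_trans)
      then show ?thesis by (simp add: one_eSuc iless_Suc_eq)
    qed
    then have "Sup ?B \<le> 0" by (rule Sup_least)
    then show False using Sup by simp
  qed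
  then obtain r where "has_betti M 1 r" "r \<noteq> 0"
    by (auto simp: one_enat_def)
  then obtain b \<mu> \<epsilon> D where res: "minimal_free_resolution M b \<mu> \<epsilon> D" and b: "b 1 \<noteq> 0"
    unfolding has_betti_def by auto
  have "b 2 = 0"
  proof (rule ccontr)
    assume "b 2 \<noteq> 0"
    \<comment> \<open>The resolution that witnesses the first Betti number would witness the second
      one as well.\<close>
    then have "enat 2 \<in> ?B" using res unfolding has_betti_def by blast
    then have "enat 2 \<le> 1" by (rule le)
    then show False by (simp add: one_enat_def)
  qed
  then show "\<exists>u. M = ideal_gen (monom_poly ` {u})"
    using principal_if_rank_2_zero[OF M res b] by blast
next
  let ?B = "{enat i |i. \<exists>r. has_betti M i r \<and> r \<noteq> 0}"
  assume "\<exists>u. M = ideal_gen (monom_poly ` {u})"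
  then obtain u where u: "M = ideal_gen (monom_poly ` {u})" ..
  have "1 \<in> ?B"
    using principal_has_betti_1[OF u M(2)] by (auto simp: one_enat_def)
  moreover have "x \<le> 1" if "x \<in> ?B" for x
  proof -
    obtain i b \<mu> \<epsilon> D where i: "x = enat i" and res: "minimal_free_resolution M b \<mu> \<epsilon> D" "b i \<noteq> 0"
      using \<open>x \<in> ?B\<close> unfolding has_betti_def by blast
    have "i \<le> 1"
    proof (rule ccontr)
      assume "\<not> i \<le> 1"
      then have "i = Suc (Suc (i - 2))" by simp
      then show False using principal_resolution_ranks[OF u M(2) res(1)] res(2) by metis
    qed
    then show ?thesis by (simp add: i one_enat_def)
  qed
  ultimately have "Sup ?B = 1"
    by (intro antisym Sup_least Sup_upper)
  then show "proj_dim M = 1" by (simp add: proj_dim_def)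
qed

text \<open>The unit ideal is excluded because there the sides differ: its minimal generating set is
  {1}, giving order of dominance 1, while S/M = 0 has no nonzero Betti number.\<close>

theorem theorem5p4:
  fixes M :: "('n::{finite,linorder}, 'k::field) mpoly set"
  assumes "monomial_ideal M" and "M \<noteq> UNIV"
  shows "proj_dim M = 1 \<longleftrightarrow> odom M = 1"
proof -
  obtain G where G: "M = ideal_gen (monom_poly ` G)" "divisibility_antichain G"
    using monomial_ideal_antichain[OF assms(1)] .
  have "(\<exists>u. M = ideal_gen (monom_poly ` {u})) \<longleftrightarrow> (\<exists>u. G = {u})"
  proof
    assume "\<exists>u. M = ideal_gen (monom_poly ` {u})"
    then obtain u where "M = ideal_gen (monom_poly ` {u})" ..
    then have "min_monom_gens M = {u}"
      by (rule min_monom_gens_eq) (simp add: divisibility_antichain_def)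
    then show "\<exists>u. G = {u}" using min_monom_gens_eq[OF G] by simp
  qed (use G in blast)
  then show ?thesis
    using proj_dim_eq_1_iff[OF G(1) assms(2)] odom_eq_1_iff[OF G] by simp
qed

end
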